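(* Let $H$ be a connected hypergraph with at least one edge and no empty edges, and let $F$ be a minimal edge cut of $H$. Let $H_i$, for $i\in I$, be the connected components of $H\setminus F$. For a function $\alpha:F\to\{ij: i,j\in I\}$ (where $ij$ denotes an unordered pair and $i=j$ is allowed), let $G_\alpha$ be the multigraph (loops and parallel edges allowed) with vertex set $I$ in which, for all $i,j\in I$, the multiplicity of the edge $ij$ is $|\alpha^{-1}(ij)|$. Then $H$ has an Euler tour if and only if there exists a function $\alpha:F\to\{ij:i,j\in I\}$ such that the following hold: (1) $G_\alpha$ has a single non-empty connected component $C^*$ (i.e. exactly one connected component with at least one edge), and the hypergraph $$H(C^* )=\Big(\bigcup_{i\in V(C^* )}H_i\Big)+\Big\{f\cap\Big(\bigcup_{i\in V(C^* )}V(H_i)\Big): f\in\alpha^{-1}(E(C^* ))\Big\}$$ has an Euler tour $T_{C^*}$; (2) $H_i$ is an empty (edgeless) connected component of $H\setminus F$ for each $i\in I\setminus V(C^* )$. Furthermore, $H$ has a spanning Euler tour if and only if there exists such an $\alpha$ satisfying (1) and (2) for which $T_{C^*}$ can be chosen to be spanning in $H(C^* )$ and $C^*$ is the only connected component of $G_\alpha$.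
   Context: A hypergraph $H=(V,E)$ has a non-empty finite vertex set $V$ and a finite collection $E$ of edges, each associated with a subset of $V$; parallel edges are allowed, so $E$ is a multiset of subsets of $V$. A walk is a sequence $v_0e_1v_1\dots v_{r-1}e_rv_r$ ($r\ge 0$) with $v_{i-1}\ne v_i$ and $v_{i-1},v_i\in e_i$ for all $i=1,\dots,r$; its anchors are $v_0,\dots,v_r$; it is closed if $v_0=v_r$, and a strict trail if its edges are pairwise distinct. $H$ is connected if any two vertices are joined by a walk; the connected components of $H$ are its maximal connected subhypergraphs $(V',E')$ with $V'\subseteq V$, $E'\subseteq E$, having no empty edges. An Euler tour of $H$ is a closed strict trail traversing every edge of $H$ exactly once; it is spanning if every vertex of $H$ is an anchor of it. For $\emptyset\neq S\subsetneq V$, the set $[S,\overline S]=\{e\in E: e\cap S\neq\emptyset,\ e\cap\overline S\neq\emptyset\}$, with $\overline S=V\setminus S$, is an edge cut of $H$; an edge cut is minimal if it properly contains no edge cut of $H$. $H\setminus F=(V,E\setminus F)$. Unions of (vertex-disjoint) hypergraphs take the union of vertex sets and of edge multisets. $H'+E'$ denotes the hypergraph obtained from $H'$ by adjoining a new copy of each member of the multiset $E'$; above, one new edge is adjoined for each $f\in\alpha^{-1}(E(C^* ))$, where $\alpha^{-1}(E(C^* ))$ is the set of $f\in F$ such that $\alpha(f)$ is an edge of $C^*$. *)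

theory Defs
  imports Main "HOL-Library.FuncSet"
begin

text \<open>Edges are labels, and each label is associated with a set of vertices: distinct labels
  with the same vertex set are parallel edges.  So a set of labels stands for a sub-multiset of
  the edge multiset.\<close>

record ('v, 'e) hypergraph =
  verts :: "'v set"
  edges :: "'e set"
  ends :: "'e \<Rightarrow> 'v set"

definition wf_hypergraph :: "('v, 'e) hypergraph \<Rightarrow> bool" where
  "wf_hypergraph H \<longleftrightarrow> verts H \<noteq> {} \<and> finite (verts H) \<and> finite (edges H)
     \<and> (\<forall>e\<in>edges H. ends H e \<subseteq> verts H)"

definition no_empty_edges :: "('v, 'e) hypergraph \<Rightarrow> bool" where
  "no_empty_edges H \<longleftrightarrow> (\<forall>e\<in>edges H. ends H e \<noteq> {})"

text \<open>The walk \<open>v\<^sub>0 e\<^sub>1 v\<^sub>1 \<dots> e\<^sub>r v\<^sub>r\<close> is given by its list \<open>vs\<close> of anchors (indices \<open>0, \<dots>, r\<close>)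
  and its list \<open>es\<close> of edges; \<open>e\<^sub>i\<close> is \<open>es ! (i - 1)\<close>.\<close>

definition walk :: "('v, 'e) hypergraph \<Rightarrow> 'v list \<Rightarrow> 'e list \<Rightarrow> bool" where
  "walk H vs es \<longleftrightarrow> length vs = Suc (length es) \<and> set vs \<subseteq> verts H \<and> set es \<subseteq> edges H
     \<and> (\<forall>i<length es. vs ! i \<noteq> vs ! Suc i \<and> vs ! i \<in> ends H (es ! i) \<and> vs ! Suc i \<in> ends H (es ! i))"

definition closed_strict_trail :: "('v, 'e) hypergraph \<Rightarrow> 'v list \<Rightarrow> 'e list \<Rightarrow> bool" where
  "closed_strict_trail H vs es \<longleftrightarrow> walk H vs es \<and> hd vs = last vs \<and> distinct es"

definition euler_tour :: "('v, 'e) hypergraph \<Rightarrow> 'v list \<Rightarrow> 'e list \<Rightarrow> bool" where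
  "euler_tour H vs es \<longleftrightarrow> closed_strict_trail H vs es \<and> set es = edges H"

definition spanning_euler_tour :: "('v, 'e) hypergraph \<Rightarrow> 'v list \<Rightarrow> 'e list \<Rightarrow> bool" where
  "spanning_euler_tour H vs es \<longleftrightarrow> euler_tour H vs es \<and> verts H \<subseteq> set vs"

definition connected_hypergraph :: "('v, 'e) hypergraph \<Rightarrow> bool" where
  "connected_hypergraph H \<longleftrightarrow>
     (\<forall>u\<in>verts H. \<forall>v\<in>verts H. \<exists>vs es. walk H vs es \<and> hd vs = u \<and> last vs = v)"

text \<open>The whole functions \<open>ends\<close> are required to agree, also on labels that are not edges, so
  that a subhypergraph is determined by its vertex set and edge set.\<close>

definition subhypergraph :: "('v, 'e) hypergraph \<Rightarrow> ('v, 'e) hypergraph \<Rightarrow> bool" where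
  "subhypergraph K H \<longleftrightarrow> wf_hypergraph K \<and> verts K \<subseteq> verts H \<and> edges K \<subseteq> edges H
     \<and> ends K = ends H"

definition components :: "('v, 'e) hypergraph \<Rightarrow> ('v, 'e) hypergraph set" where
  "components H =
     {K. subhypergraph K H \<and> connected_hypergraph K \<and> no_empty_edges K
       \<and> (\<forall>K'. subhypergraph K' H \<and> connected_hypergraph K' \<and> no_empty_edges K'
              \<and> subhypergraph K K' \<longrightarrow> K' = K)}"

definition cut_edges :: "('v, 'e) hypergraph \<Rightarrow> 'v set \<Rightarrow> 'e set" where
  "cut_edges H S = {e \<in> edges H. ends H e \<inter> S \<noteq> {} \<and> ends H e \<inter> (verts H - S) \<noteq> {}}"

definition edge_cut :: "('v, 'e) hypergraph \<Rightarrow> 'e set \<Rightarrow> bool" where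
  "edge_cut H F \<longleftrightarrow> (\<exists>S. S \<noteq> {} \<and> S \<subset> verts H \<and> F = cut_edges H S)"

definition minimal_edge_cut :: "('v, 'e) hypergraph \<Rightarrow> 'e set \<Rightarrow> bool" where
  "minimal_edge_cut H F \<longleftrightarrow> edge_cut H F \<and> \<not> (\<exists>F'. edge_cut H F' \<and> F' \<subset> F)"

definition delete_edges :: "('v, 'e) hypergraph \<Rightarrow> 'e set \<Rightarrow> ('v, 'e) hypergraph" where
  "delete_edges H F = H\<lparr>edges := edges H - F\<rparr>"

text \<open>Labels are tagged with the index of the member they come from, so that the edges form the
  multiset union of the families even if two members happen to share labels.\<close>

definition hypergraph_Union ::
  "'i set \<Rightarrow> ('i \<Rightarrow> ('v, 'e) hypergraph) \<Rightarrow> ('v, 'i \<times> 'e) hypergraph" where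
  "hypergraph_Union J K =
     \<lparr>verts = (\<Union>i\<in>J. verts (K i)), edges = (SIGMA i:J. edges (K i)),
      ends = (\<lambda>(i, e). ends (K i) e)\<rparr>"

text \<open>\<open>H + {g f : f \<in> A}\<close>: one new edge, with vertex set \<open>g f\<close>, for each \<open>f \<in> A\<close>.\<close>

definition adjoin_edges ::
  "('v, 'e) hypergraph \<Rightarrow> 'f set \<Rightarrow> ('f \<Rightarrow> 'v set) \<Rightarrow> ('v, 'e + 'f) hypergraph" where
  "adjoin_edges H A g =
     \<lparr>verts = verts H, edges = edges H <+> A, ends = case_sum (ends H) g\<rparr>"

definition unordered_pairs :: "'i set \<Rightarrow> 'i set set" where
  "unordered_pairs I = {{i, j} | i j. i \<in> I \<and> j \<in> I}"

text \<open>A multigraph is a hypergraph whose edges have two vertices, or one vertex for a loop.  In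
  \<open>G\<^sub>\<alpha>\<close> each \<open>f \<in> F\<close> is an edge with end set \<open>\<alpha> f\<close>, so \<open>ij\<close> has multiplicity \<open>|\<alpha>\<^sup>-\<^sup>1(ij)|\<close>.\<close>

definition G_alpha :: "'i set \<Rightarrow> 'e set \<Rightarrow> ('e \<Rightarrow> 'i set) \<Rightarrow> ('i, 'e) hypergraph" where
  "G_alpha I F \<alpha> = \<lparr>verts = I, edges = F, ends = \<alpha>\<rparr>"

definition only_nonempty_component :: "('v, 'e) hypergraph \<Rightarrow> ('v, 'e) hypergraph \<Rightarrow> bool" where
  "only_nonempty_component G C \<longleftrightarrow> C \<in> components G \<and> edges C \<noteq> {}
     \<and> (\<forall>C'\<in>components G. edges C' \<noteq> {} \<longrightarrow> C' = C)"

text \<open>\<open>H(C)\<close>, for a family \<open>K\<close> of hypergraphs indexed by the vertices of \<open>C\<close>.  The preimage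
  \<open>\<alpha>\<^sup>-\<^sup>1(E(C))\<close> refers to the edges of \<open>C\<close> as unordered pairs, hence to the image of its edge
  labels under \<open>ends C\<close>.\<close>

definition H_component ::
  "('v, 'e) hypergraph \<Rightarrow> 'e set \<Rightarrow> ('i \<Rightarrow> ('v, 'e) hypergraph) \<Rightarrow> ('e \<Rightarrow> 'i set)
     \<Rightarrow> ('i, 'e) hypergraph \<Rightarrow> ('v, 'i \<times> 'e + 'e) hypergraph" where
  "H_component H F K \<alpha> C =
     adjoin_edges (hypergraph_Union (verts C) K)
       {f \<in> F. \<alpha> f \<in> ends C ` edges C}
       (\<lambda>f. ends H f \<inter> (\<Union>i\<in>verts C. verts (K i)))"

end

theory Submission
  imports Defs
begin

text \<open>An Euler tour of \<open>H\<close> and an Euler tour of \<open>H(C\<^sup>*)\<close> are the same sequence of anchors, read with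
  different names for the edges.

  Given a tour of \<open>H\<close>, send each \<open>f \<in> F\<close> to the pair of indices of the components of \<open>H \ F\<close> that
  contain the two anchors next to \<open>f\<close> in the tour (\<open>tour_yields_alpha\<close>).  An edge outside \<open>F\<close>
  stays inside one component, so along the tour consecutive anchors have indices that are equal or
  joined by an edge of \<open>G\<^sub>\<alpha>\<close>; hence the set \<open>W\<close> of indices visited by the tour is connected in
  \<open>G\<^sub>\<alpha>\<close>.  Every edge of \<open>G\<^sub>\<alpha>\<close> has its ends in \<open>W\<close>, because the tour uses every \<open>f \<in> F\<close>.  So \<open>W\<close>
  with all of \<open>F\<close> is a component, and it is the only one with edges.  The tour only visits
  vertices in components with index in \<open>W\<close>, and each edge it uses lies in such a component or in
  \<open>F\<close>: it is a tour of \<open>H(C\<^sup>*)\<close>, and the components with index outside \<open>W\<close> have no edges.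

  Conversely (\<open>tour_from_alpha\<close>), a tour of \<open>H(C\<^sup>*)\<close> becomes a strict trail of \<open>H\<close> when the shrunk
  edges \<open>f \<inter> \<dots>\<close> are replaced by \<open>f\<close>, and it misses no edge of \<open>H\<close>: each \<open>f \<in> F\<close> is an edge of
  some component of \<open>G\<^sub>\<alpha>\<close>, which must be \<open>C\<^sup>*\<close>, and an edge outside \<open>F\<close> lies in some \<open>H\<^sub>i\<close>, where
  \<open>i\<close> is a vertex of \<open>C\<^sup>*\<close> by condition (2).

  A spanning tour of \<open>H\<close> visits every component of \<open>H \ F\<close>, so then \<open>V(C\<^sup>*) = I\<close>, which says that
  \<open>C\<^sup>*\<close> is the only component of \<open>G\<^sub>\<alpha>\<close>.  And when \<open>V(C\<^sup>*) = I\<close>, the hypergraphs \<open>H\<close> and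
  \<open>H(C\<^sup>*)\<close> have the same vertices; as the anchors do not change, the tour is spanning in one if
  and only if it is spanning in the other.

  That \<open>G\<^sub>\<alpha>\<close> has an edge at all is the connectedness of \<open>H\<close>: an edge cut of a connected
  hypergraph is not empty (\<open>edge_cut_nonempty\<close>).\<close>

section \<open>Reachability and connected components\<close>

definition adjacent :: "('v, 'e) hypergraph \<Rightarrow> 'v \<Rightarrow> 'v \<Rightarrow> bool" where
  "adjacent H u v \<longleftrightarrow> u \<in> verts H \<and> v \<in> verts H \<and> u \<noteq> v
     \<and> (\<exists>e\<in>edges H. u \<in> ends H e \<and> v \<in> ends H e)"

abbreviation reachable :: "('v, 'e) hypergraph \<Rightarrow> 'v \<Rightarrow> 'v \<Rightarrow> bool" where
  "reachable H \<equiv> (adjacent H)\<^sup>*\<^sup>*"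

lemma reachable_sym: "reachable H u v \<Longrightarrow> reachable H v u"
  by (metis adjacent_def sympI sympD symp_rtranclp)

lemma reachable_in_verts: "reachable H u v \<Longrightarrow> u \<in> verts H \<Longrightarrow> v \<in> verts H"
  by (induction rule: rtranclp_induct) (auto simp: adjacent_def)

lemma walk_reachable:
  assumes "walk H vs es" "i < length vs"
  shows "reachable H (hd vs) (vs ! i)"
  using assms(2)
proof (induction i)
  case 0
  then show ?case by (simp add: hd_conv_nth)
next
  case (Suc i)
  then have "i < length es" using assms(1) by (simp add: walk_def)
  then have "adjacent H (vs ! i) (vs ! Suc i)"
    using assms(1) Suc.prems unfolding walk_def adjacent_def
    by (metis Suc_lessD nth_mem subsetD)
  then show ?case using Suc by (meson Suc_lessD rtranclp.rtrancl_into_rtrancl)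
qed

lemma walk_of_reachable:
  assumes "reachable H u v" "u \<in> verts H"
  shows "\<exists>vs es. walk H vs es \<and> hd vs = u \<and> last vs = v"
  using assms
proof (induction rule: rtranclp_induct)
  case base
  then show ?case by (intro exI[of _ "[u]"] exI[of _ "[]"]) (simp add: walk_def)
next
  case (step y z)
  then obtain vs es where w: "walk H vs es" "hd vs = u" "last vs = y" by blast
  obtain e where e: "e \<in> edges H" "y \<in> ends H e" "z \<in> ends H e" "y \<noteq> z" "z \<in> verts H"
    using step.hyps(2) by (auto simp: adjacent_def)
  have len: "length vs = Suc (length es)" using w(1) by (simp add: walk_def)
  then have "vs \<noteq> []" "vs ! length es = y"
    using w(3) by (auto simp: last_conv_nth simp flip: length_greater_0_conv)
  then have "walk H (vs @ [z]) (es @ [e])"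
    using w(1) e len unfolding walk_def
    by (auto simp: nth_append less_Suc_eq)
  moreover have "hd (vs @ [z]) = u" using w(2) \<open>vs \<noteq> []\<close> by simp
  ultimately show ?case by (metis last_snoc)
qed

text \<open>Connectedness is used in this form throughout: existence of walks becomes a
  transitive closure, which has the induction rules that lists of anchors and edges lack.\<close>

lemma connected_iff_reachable:
  "connected_hypergraph H \<longleftrightarrow> (\<forall>u\<in>verts H. \<forall>v\<in>verts H. reachable H u v)"
proof -
  have "reachable H u v" if "walk H vs es" "hd vs = u" "last vs = v" for u v vs es
  proof -
    have "vs \<noteq> []" using that(1) by (auto simp: walk_def)
    then show ?thesis
      using walk_reachable[OF that(1), of "length vs - 1"] that(2,3) by (simp add: last_conv_nth)
  qed
  then show ?thesis
    unfolding connected_hypergraph_def using walk_of_reachable by metis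
qed

lemma reachable_mono:
  assumes "reachable K u v" "subhypergraph K H"
  shows "reachable H u v"
proof -
  have "adjacent K x y \<Longrightarrow> adjacent H x y" for x y
    using assms(2) unfolding subhypergraph_def adjacent_def by (metis subsetD)
  then have "adjacent K \<le> adjacent H" by blast
  then show ?thesis using assms(1) rtranclp_mono by blast
qed

text \<open>A non-empty edge that meets the vertices reachable from \<open>v\<close> lies inside them, so containment
  selects the same edges as a common vertex would; it is preferred because a subhypergraph must
  contain the ends of its edges.\<close>

definition component_at :: "('v, 'e) hypergraph \<Rightarrow> 'v \<Rightarrow> ('v, 'e) hypergraph" where
  "component_at H v =
     \<lparr>verts = {u. reachable H v u}, edges = {e \<in> edges H. ends H e \<subseteq> {u. reachable H v u}},
      ends = ends H\<rparr>"

lemma component_at_subhypergraph: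
  assumes "wf_hypergraph H" "v \<in> verts H"
  shows "subhypergraph (component_at H v) H"
proof -
  have "{u. reachable H v u} \<subseteq> verts H" using reachable_in_verts assms(2) by fast
  then show ?thesis
    using assms(1) finite_subset
    unfolding subhypergraph_def wf_hypergraph_def component_at_def by auto
qed

lemma component_at_connected:
  assumes "wf_hypergraph H" "v \<in> verts H"
  shows "connected_hypergraph (component_at H v)"
proof -
  have "reachable (component_at H v) v u" if "reachable H v u" for u
    using that
  proof (induction rule: rtranclp_induct)
    case (step y z)
    obtain e where e: "e \<in> edges H" "y \<in> ends H e" "z \<in> ends H e" "y \<noteq> z"
      using step.hyps(2) by (auto simp: adjacent_def)
    have "reachable H v x" if "x \<in> ends H e" for x
    proof (cases "x = y")
      case False
      then have "adjacent H y x"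
        using e that assms(1) unfolding adjacent_def wf_hypergraph_def by blast
      then show ?thesis using step.hyps(1) by simp
    qed (use step.hyps(1) in simp)
    then have "adjacent (component_at H v) y z"
      using e unfolding adjacent_def component_at_def by auto
    then show ?case using step.IH by simp
  qed simp
  then show ?thesis
    unfolding connected_iff_reachable
    by (metis (mono_tags, lifting) component_at_def hypergraph.select_convs(1) mem_Collect_eq
        reachable_sym rtranclp_trans)
qed

lemma subhypergraph_component_at:
  assumes "subhypergraph K H" "connected_hypergraph K" "v \<in> verts K"
  shows "subhypergraph K (component_at H v)"
proof -
  have "verts K \<subseteq> {u. reachable H v u}"
    using assms reachable_mono unfolding connected_iff_reachable by fast
  moreover have "ends H e \<subseteq> verts K" if "e \<in> edges K" for e
    using assms(1) that unfolding subhypergraph_def wf_hypergraph_def by metis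
  ultimately have "edges K \<subseteq> {e \<in> edges H. ends H e \<subseteq> {u. reachable H v u}}"
    using assms(1) unfolding subhypergraph_def by blast
  with \<open>verts K \<subseteq> _\<close> show ?thesis
    using assms(1) unfolding subhypergraph_def component_at_def by simp
qed

lemma subhypergraph_antisym:
  "subhypergraph K (L :: ('v, 'e) hypergraph) \<Longrightarrow> subhypergraph L K \<Longrightarrow> K = L"
  unfolding subhypergraph_def by (intro hypergraph.equality) auto

lemma component_at_no_empty_edges:
  "no_empty_edges H \<Longrightarrow> no_empty_edges (component_at H v)"
  by (simp add: no_empty_edges_def component_at_def)

text \<open>Every connected subhypergraph through \<open>v\<close> lies inside \<open>component_at H v\<close>, which is itself one
  of them.  A greatest element is the only maximal one, so the components are exactly the
  hypergraphs \<open>component_at H v\<close>.\<close>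

lemma component_at_in_components:
  assumes "wf_hypergraph H" "no_empty_edges H" "v \<in> verts H"
  shows "component_at H v \<in> components H"
proof -
  have "K = component_at H v"
    if "subhypergraph K H" "connected_hypergraph K" "subhypergraph (component_at H v) K" for K
  proof (rule subhypergraph_antisym[OF subhypergraph_component_at that(3)])
    show "v \<in> verts K" using that(3) by (auto simp: subhypergraph_def component_at_def)
  qed (use that in auto)
  then show ?thesis
    using component_at_subhypergraph[OF assms(1,3)] component_at_connected[OF assms(1,3)]
      component_at_no_empty_edges[OF assms(2)]
    by (simp add: components_def)
qed

lemma components_eq_component_at:
  assumes "wf_hypergraph H" "no_empty_edges H" "K \<in> components H" "v \<in> verts K"
  shows "K = component_at H v"
proof -
  have "v \<in> verts H" using assms(3,4) by (auto simp: components_def subhypergraph_def)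
  moreover have "subhypergraph K (component_at H v)"
    using subhypergraph_component_at assms(3,4) by (auto simp: components_def)
  ultimately show ?thesis
    using assms(3) component_at_subhypergraph[OF assms(1)] component_at_connected[OF assms(1)]
      component_at_no_empty_edges[OF assms(2)]
    unfolding components_def by blast
qed

lemma components_disjoint:
  assumes "wf_hypergraph H" "no_empty_edges H" "K \<in> components H" "L \<in> components H"
    "v \<in> verts K" "v \<in> verts L"
  shows "K = L"
  using components_eq_component_at[OF assms(1,2,3,5)]
    components_eq_component_at[OF assms(1,2,4,6)] by simp

lemma components_cover_verts:
  assumes "wf_hypergraph H" "no_empty_edges H" "v \<in> verts H"
  shows "\<exists>K\<in>components H. v \<in> verts K"
  using component_at_in_components[OF assms] by (force simp: component_at_def)

lemma components_cover_edges:
  assumes "wf_hypergraph H" "no_empty_edges H" "e \<in> edges H"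
  shows "\<exists>K\<in>components H. e \<in> edges K"
proof -
  obtain v where v: "v \<in> ends H e" using assms(2,3) by (auto simp: no_empty_edges_def)
  have sub: "ends H e \<subseteq> verts H" using assms(1,3) by (auto simp: wf_hypergraph_def)
  have "reachable H v u" if "u \<in> ends H e" for u
  proof (cases "u = v")
    case False
    then have "adjacent H v u" using v sub that assms(3) by (auto simp: adjacent_def)
    then show ?thesis by simp
  qed simp
  then have "e \<in> edges (component_at H v)" using assms(3) by (auto simp: component_at_def)
  then show ?thesis using component_at_in_components[OF assms(1,2)] v sub by blast
qed

lemma component_edge_ends:
  assumes "K \<in> components H" "e \<in> edges K"
  shows "e \<in> edges H" "ends K e = ends H e" "ends H e \<subseteq> verts K" "ends H e \<noteq> {}"
proof -
  have sub: "subhypergraph K H" and ne: "no_empty_edges K"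
    using assms(1) by (auto simp: components_def)
  show "e \<in> edges H" "ends K e = ends H e" using assms(2) sub by (auto simp: subhypergraph_def)
  then show "ends H e \<subseteq> verts K" "ends H e \<noteq> {}"
    using assms(2) sub ne unfolding subhypergraph_def wf_hypergraph_def no_empty_edges_def
    by metis+
qed

lemma finite_components:
  assumes "wf_hypergraph H" "no_empty_edges H"
  shows "finite (components H)"
proof (rule finite_subset)
  show "components H \<subseteq> component_at H ` verts H"
  proof
    fix K assume K: "K \<in> components H"
    then have "verts K \<noteq> {}" "verts K \<subseteq> verts H"
      by (auto simp: components_def subhypergraph_def wf_hypergraph_def)
    then show "K \<in> component_at H ` verts H"
      using components_eq_component_at[OF assms K] by blast
  qed
  show "finite (component_at H ` verts H)" using assms(1) by (simp add: wf_hypergraph_def)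
qed

lemma sole_component_iff_spanning:
  assumes "wf_hypergraph H" "no_empty_edges H" "K \<in> components H"
  shows "components H = {K} \<longleftrightarrow> verts K = verts H"
proof
  assume "components H = {K}"
  then show "verts K = verts H"
    using components_cover_verts[OF assms(1,2)] assms(3)
    by (auto simp: components_def subhypergraph_def)
next
  assume eq: "verts K = verts H"
  have "L = K" if L: "L \<in> components H" for L
  proof -
    have "verts L \<noteq> {}" "verts L \<subseteq> verts H"
      using L by (auto simp: components_def subhypergraph_def wf_hypergraph_def)
    then obtain v where "v \<in> verts L" "v \<in> verts K" using eq by blast
    then show ?thesis using components_disjoint[OF assms(1,2) L assms(3)] by blast
  qed
  then show "components H = {K}" using assms(3) by blast
qed

text \<open>If no edge crosses \<open>S\<close>, no walk leaves \<open>S\<close>.\<close>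

lemma edge_cut_nonempty:
  assumes "connected_hypergraph H" "edge_cut H F"
  shows "F \<noteq> {}"
proof
  assume "F = {}"
  obtain S where S: "S \<noteq> {}" "S \<subset> verts H" "F = cut_edges H S"
    using assms(2) by (auto simp: edge_cut_def)
  obtain u v where uv: "u \<in> S" "u \<in> verts H" "v \<in> verts H" "v \<notin> S" using S by blast
  have "x \<in> S" if "reachable H u x" for x
    using that
  proof (induction rule: rtranclp_induct)
    case (step y z)
    then show ?case using S(3) \<open>F = {}\<close> by (auto simp: adjacent_def cut_edges_def)
  qed (use uv in simp)
  then show False using assms(1) uv unfolding connected_iff_reachable by blast
qed

section \<open>Euler tours across the removed edges\<close>

text \<open>The pieces are the components of \<open>H \ F\<close>.  They partition the vertices of \<open>H\<close> and the edges
  outside \<open>F\<close>, so a vertex or such an edge determines the index of its piece.\<close>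

locale indexed_pieces =
  fixes H :: "('v, 'e) hypergraph" and F :: "'e set" and I :: "'i set"
    and Hc :: "'i \<Rightarrow> ('v, 'e) hypergraph"
  assumes wf: "wf_hypergraph H"
    and nonempty: "no_empty_edges H"
    and F_edges: "F \<subseteq> edges H"
    and pieces: "bij_betw Hc I (components (delete_edges H F))"
begin

lemma wf_delete: "wf_hypergraph (delete_edges H F)"
  using wf by (simp add: wf_hypergraph_def delete_edges_def)

lemma nonempty_delete: "no_empty_edges (delete_edges H F)"
  using nonempty by (simp add: no_empty_edges_def delete_edges_def)

lemma piece_component: "i \<in> I \<Longrightarrow> Hc i \<in> components (delete_edges H F)"
  using pieces by (auto simp: bij_betw_def)

lemma piece_of_component: "K \<in> components (delete_edges H F) \<Longrightarrow> \<exists>i\<in>I. Hc i = K"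
  using bij_betw_imp_surj_on[OF pieces] by (metis imageE)

lemma finite_index: "finite I"
  using finite_components[OF wf_delete nonempty_delete] bij_betw_finite[OF pieces] by simp

lemma piece_unique:
  assumes "i \<in> I" "j \<in> I" "v \<in> verts (Hc i)" "v \<in> verts (Hc j)"
  shows "i = j"
proof -
  have "Hc i = Hc j"
    using components_disjoint[OF wf_delete nonempty_delete] piece_component assms by blast
  then show ?thesis using pieces assms(1,2) by (auto simp: bij_betw_def inj_on_def)
qed

lemma piece_verts: "i \<in> I \<Longrightarrow> verts (Hc i) \<subseteq> verts H" "i \<in> I \<Longrightarrow> verts (Hc i) \<noteq> {}"
  using piece_component[of i]
  by (auto simp: components_def subhypergraph_def wf_hypergraph_def delete_edges_def)

lemma vert_in_piece: "v \<in> verts H \<Longrightarrow> \<exists>i\<in>I. v \<in> verts (Hc i)"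
  using components_cover_verts[OF wf_delete nonempty_delete, of v] piece_of_component
  by (fastforce simp: delete_edges_def)

lemma edge_in_piece: "e \<in> edges H \<Longrightarrow> e \<notin> F \<Longrightarrow> \<exists>i\<in>I. e \<in> edges (Hc i)"
  using components_cover_edges[OF wf_delete nonempty_delete, of e] piece_of_component
  by (fastforce simp: delete_edges_def)

lemma piece_edge:
  assumes "i \<in> I" "e \<in> edges (Hc i)"
  shows "e \<in> edges H" "e \<notin> F" "ends (Hc i) e = ends H e" "ends H e \<subseteq> verts (Hc i)"
    "ends H e \<noteq> {}"
  using component_edge_ends[OF piece_component[OF assms(1)] assms(2)]
  by (auto simp: delete_edges_def)

lemma piece_edge_unique:
  assumes "i \<in> I" "j \<in> I" "e \<in> edges (Hc i)" "e \<in> edges (Hc j)"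
  shows "i = j"
proof -
  obtain v where "v \<in> ends H e" using piece_edge(5) assms by blast
  then show ?thesis
    using piece_unique[OF assms(1,2)] piece_edge(4) assms by blast
qed

lemma wf_G_alpha:
  assumes "\<alpha> \<in> F \<rightarrow> unordered_pairs I" "F \<noteq> {}"
  shows "wf_hypergraph (G_alpha I F \<alpha>)" "no_empty_edges (G_alpha I F \<alpha>)"
proof -
  have pair: "\<alpha> f \<subseteq> I \<and> \<alpha> f \<noteq> {}" if "f \<in> F" for f
    using assms(1) that by (fastforce simp: unordered_pairs_def Pi_iff)
  have "finite F" using wf F_edges finite_subset by (auto simp: wf_hypergraph_def)
  then show "wf_hypergraph (G_alpha I F \<alpha>)" "no_empty_edges (G_alpha I F \<alpha>)"
    using pair finite_index assms(2)
    by (auto simp: wf_hypergraph_def no_empty_edges_def G_alpha_def)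
qed

text \<open>The component \<open>C\<close> is described by the pieces that the tour meets, and the anchors \<open>vs\<close> are the
  same in both tours, because the spanning version compares \<open>V(C)\<close> with \<open>I\<close> and the anchors with
  the vertices.\<close>

lemma tour_yields_alpha:
  assumes tour: "euler_tour H vs es" and F_ne: "F \<noteq> {}"
  shows "\<exists>\<alpha> \<in> F \<rightarrow> unordered_pairs I. \<exists>C es'.
    only_nonempty_component (G_alpha I F \<alpha>) C
    \<and> verts C = {i \<in> I. set vs \<inter> verts (Hc i) \<noteq> {}}
    \<and> euler_tour (H_component H F Hc \<alpha> C) vs es'
    \<and> (\<forall>i \<in> I - verts C. edges (Hc i) = {})"
proof -
  have w: "walk H vs es" and cl: "hd vs = last vs" and dist: "distinct es"
    and all: "set es = edges H"
    using tour by (auto simp: euler_tour_def closed_strict_trail_def)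
  have len: "length vs = Suc (length es)" and vsH: "set vs \<subseteq> verts H"
    using w by (auto simp: walk_def)
  have step: "vs ! k \<noteq> vs ! Suc k" "vs ! k \<in> ends H (es ! k)" "vs ! Suc k \<in> ends H (es ! k)"
    "vs ! k \<in> set vs" "vs ! Suc k \<in> set vs"
    if "k < length es" for k
    using w that len by (auto simp: walk_def)
  obtain c where c: "\<And>v. v \<in> verts H \<Longrightarrow> c v \<in> I \<and> v \<in> verts (Hc (c v))"
    using vert_in_piece by metis
  have c_eq: "c v = i" if "i \<in> I" "v \<in> verts (Hc i)" for v i
    using piece_unique c piece_verts(1) that by (meson subsetD)
  obtain pos where pos: "\<And>e. e \<in> edges H \<Longrightarrow> pos e < length es \<and> es ! pos e = e"
  proof -
    have "\<forall>e\<in>edges H. \<exists>k. k < length es \<and> es ! k = e"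
      using all by (auto simp: in_set_conv_nth)
    then show ?thesis using that by metis
  qed
  have pos_nth: "pos (es ! k) = k" if "k < length es" for k
    using pos[of "es ! k"] that all nth_eq_iff_index_eq[OF dist] nth_mem[OF that] by blast
  \<comment> \<open>\<open>pos f\<close> is the place of \<open>f\<close> in the tour, and \<open>c v\<close> the index of the piece containing \<open>v\<close>.\<close>
  define \<alpha> where "\<alpha> f = {c (vs ! pos f), c (vs ! Suc (pos f))}" for f
  define W where "W = c ` set vs"
  define C where "C = \<lparr>verts = W, edges = F, ends = \<alpha>\<rparr>"
  have W_I: "W \<subseteq> I" using c vsH by (auto simp: W_def)
  have alpha_W: "\<alpha> f \<subseteq> W" "\<alpha> f \<noteq> {}" if "f \<in> F" for f
    using that F_edges pos[of f] step(4,5)[of "pos f"] by (auto simp: \<alpha>_def W_def)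
  have alpha: "\<alpha> \<in> F \<rightarrow> unordered_pairs I"
  proof
    fix f assume "f \<in> F"
    then show "\<alpha> f \<in> unordered_pairs I"
      using alpha_W[of f] W_I unfolding \<alpha>_def unordered_pairs_def by blast
  qed
  have finF: "finite F" using wf F_edges finite_subset by (auto simp: wf_hypergraph_def)
  have W_vs: "W = {i \<in> I. set vs \<inter> verts (Hc i) \<noteq> {}}"
  proof (rule equalityI; rule subsetI)
    fix i assume "i \<in> W"
    then obtain v where "v \<in> set vs" "i = c v" by (auto simp: W_def)
    then show "i \<in> {i \<in> I. set vs \<inter> verts (Hc i) \<noteq> {}}" using c[of v] vsH by blast
  next
    fix i assume "i \<in> {i \<in> I. set vs \<inter> verts (Hc i) \<noteq> {}}"
    then obtain v where "i \<in> I" "v \<in> set vs" "v \<in> verts (Hc i)" by blast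
    then show "i \<in> W" using c_eq unfolding W_def by blast
  qed
  have edge_c: "c v = i" if "i \<in> I" "e \<in> edges (Hc i)" "v \<in> ends H e" for v e i
    using that piece_edge(4) c_eq by blast

  have C_sub: "subhypergraph C (G_alpha I F \<alpha>)"
    using alpha_W W_I F_ne finF
    by (auto simp: subhypergraph_def wf_hypergraph_def C_def G_alpha_def W_def)
  have C_ne: "no_empty_edges C"
    using alpha_W by (auto simp: no_empty_edges_def C_def)
  \<comment> \<open>The tour projects to a walk of \<open>C\<close> that pauses at each edge outside \<open>F\<close>, and at each edge in
    \<open>F\<close> whose two anchors lie in the same piece: such an edge is a loop of \<open>G\<^sub>\<alpha>\<close>.\<close>
  have reach: "reachable C (c (vs ! 0)) (c (vs ! k))" if "k < length vs" for k
    using that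
  proof (induction k)
    case (Suc k)
    then have k: "k < length es" using len by simp
    have "reachable C (c (vs ! k)) (c (vs ! Suc k))"
    proof (cases "es ! k \<in> F")
      case True
      then have "c (vs ! k) \<noteq> c (vs ! Suc k) \<longrightarrow> adjacent C (c (vs ! k)) (c (vs ! Suc k))"
        using pos_nth[OF k] step(4,5)[OF k]
        unfolding adjacent_def C_def \<alpha>_def W_def by force
      then show ?thesis by (cases "c (vs ! k) = c (vs ! Suc k)") auto
    next
      case False
      moreover have "es ! k \<in> edges H" using all k nth_mem by blast
      ultimately obtain i where "i \<in> I" "es ! k \<in> edges (Hc i)" using edge_in_piece by blast
      then have "c (vs ! k) = c (vs ! Suc k)" using edge_c step[OF k] by metis
      then show ?thesis by simp
    qed
    then show ?case using Suc by simp
  qed simp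
  have C_conn: "connected_hypergraph C"
  proof -
    have "reachable C (c (vs ! 0)) i" if "i \<in> verts C" for i
      using that reach unfolding C_def W_def by (auto simp: in_set_conv_nth)
    then show ?thesis
      unfolding connected_iff_reachable by (metis reachable_sym rtranclp_trans)
  qed
  have C_max: "K = C"
    if K: "subhypergraph K (G_alpha I F \<alpha>)" "connected_hypergraph K" "subhypergraph C K" for K
  proof -
    have K_edges: "edges K \<subseteq> F" "ends K = \<alpha>" and C_K: "W \<subseteq> verts K"
      using K by (auto simp: subhypergraph_def G_alpha_def C_def)
    have stay: "i \<in> W" if "reachable K j i" "j \<in> W" for i j
      using that
    proof (induction rule: rtranclp_induct)
      case (step y z)
      then show ?case using alpha_W(1) K_edges by (auto simp: adjacent_def)
    qed
    have "vs ! 0 \<in> set vs" using len by simp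
    then have "c (vs ! 0) \<in> W" by (simp add: W_def)
    then have "verts K \<subseteq> W" using stay K(2) C_K unfolding connected_iff_reachable by blast
    then have "subhypergraph K C"
      using K(1) by (auto simp: subhypergraph_def G_alpha_def C_def)
    then show ?thesis using subhypergraph_antisym K(3) by blast
  qed
  have C_comp: "C \<in> components (G_alpha I F \<alpha>)"
    using C_sub C_ne C_conn C_max unfolding components_def by blast
  have "L = C" if L: "L \<in> components (G_alpha I F \<alpha>)" "edges L \<noteq> {}" for L
  proof -
    obtain f where "f \<in> edges L" using L(2) by blast
    then have "f \<in> F" "\<alpha> f \<subseteq> verts L"
      using component_edge_ends[OF L(1)] by (auto simp: G_alpha_def)
    then obtain i where "i \<in> verts L" "i \<in> verts C"
      using alpha_W[of f] by (auto simp: C_def)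
    then show ?thesis using components_disjoint[OF wf_G_alpha[OF alpha F_ne] L(1) C_comp] by blast
  qed
  moreover have "edges C \<noteq> {}" using F_ne by (simp add: C_def)
  ultimately have only: "only_nonempty_component (G_alpha I F \<alpha>) C"
    using C_comp unfolding only_nonempty_component_def by blast

  have visited: "i \<in> W" if "i \<in> I" "e \<in> edges (Hc i)" for i e
  proof -
    have "e \<in> edges H" using piece_edge(1)[OF that] .
    then have "pos e < length es" "es ! pos e = e" using pos by auto
    then have "vs ! pos e \<in> ends H e" "vs ! pos e \<in> set vs" using step[of "pos e"] by auto
    then show ?thesis using edge_c[OF that] by (auto simp: W_def)
  qed
  then have empty_outside: "\<forall>i \<in> I - verts C. edges (Hc i) = {}" by (auto simp: C_def)

  obtain d where d: "\<And>e. e \<in> edges H \<Longrightarrow> e \<notin> F \<Longrightarrow> d e \<in> I \<and> e \<in> edges (Hc (d e))"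
    using edge_in_piece by metis
  \<comment> \<open>The edge \<open>e\<close> of \<open>H\<close> under the name it has in \<open>H(C)\<close>: edges in \<open>F\<close> are adjoined, all others
    are tagged with the index of their piece.\<close>
  define label where "label e = (if e \<in> F then Inr e else Inl (d e, e))" for e
  let ?HC = "H_component H F Hc \<alpha> C"
  have HC: "verts ?HC = (\<Union>i\<in>W. verts (Hc i))"
    "edges ?HC = (SIGMA i:W. edges (Hc i)) <+> F"
    "ends ?HC = case_sum (\<lambda>(i, e). ends (Hc i) e) (\<lambda>f. ends H f \<inter> (\<Union>i\<in>W. verts (Hc i)))"
    by (auto simp: H_component_def adjoin_edges_def hypergraph_Union_def C_def)
  have vsW: "set vs \<subseteq> (\<Union>i\<in>W. verts (Hc i))" using c vsH by (auto simp: W_def)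
  have label_edges: "label ` edges H = edges ?HC"
  proof (rule equalityI; rule subsetI)
    fix x assume "x \<in> label ` edges H"
    then show "x \<in> edges ?HC" using d visited by (auto simp: HC label_def)
  next
    fix x assume "x \<in> edges ?HC"
    then consider i e where "x = Inl (i, e)" "i \<in> W" "e \<in> edges (Hc i)" | f where "x = Inr f" "f \<in> F"
      by (auto simp: HC)
    then show "x \<in> label ` edges H"
    proof cases
      case 1
      then have "i \<in> I" using W_I by blast
      then have e: "e \<in> edges H" "e \<notin> F" using piece_edge 1(3) by blast+
      then have "d e = i" using d piece_edge_unique \<open>i \<in> I\<close> 1(3) by blast
      then have "x = label e" using 1 e by (simp add: label_def)
      then show ?thesis using e by blast
    next
      case 2
      then have "x = label f" by (simp add: label_def)
      then show ?thesis using 2 F_edges by blast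
    qed
  qed
  have ends_label: "v \<in> ends ?HC (label e)" if "e \<in> edges H" "v \<in> ends H e" "v \<in> set vs" for e v
    using that vsW d piece_edge(3) by (auto simp: HC label_def)
  have "walk ?HC vs (map label es)"
    unfolding walk_def
  proof (intro conjI allI impI)
    fix k assume "k < length (map label es)"
    then have k: "k < length es" by simp
    then have "es ! k \<in> edges H" using all nth_mem by blast
    then show "vs ! k \<noteq> vs ! Suc k" "vs ! k \<in> ends ?HC (map label es ! k)"
      "vs ! Suc k \<in> ends ?HC (map label es ! k)"
      using step[OF k] ends_label k by simp_all
  qed (use len vsW label_edges all in \<open>auto simp: HC(1)\<close>)
  moreover have "inj_on label (edges H)" by (auto simp: inj_on_def label_def split: if_splits)
  ultimately have "euler_tour ?HC vs (map label es)"
    using cl dist all label_edges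
    by (simp add: euler_tour_def closed_strict_trail_def distinct_map)
  then show ?thesis
    using alpha only empty_outside W_vs by (intro bexI[of _ \<alpha>] exI[of _ C]) (auto simp: C_def)
qed

lemma verts_H_component:
  "verts (H_component H F Hc \<alpha> C) = (\<Union>i\<in>verts C. verts (Hc i))"
  by (simp add: H_component_def adjoin_edges_def hypergraph_Union_def)

lemma verts_pieces: "(\<Union>i\<in>I. verts (Hc i)) = verts H"
  using piece_verts(1) vert_in_piece by blast

text \<open>Forgetting the tags is injective, as each edge lies in one piece only, and an edge of \<open>H(C)\<close>
  is contained in the edge of \<open>H\<close> that it comes from.  So a strict trail stays a strict trail; the
  two conditions on \<open>\<alpha>\<close> are what make it reach every edge of \<open>H\<close>.\<close>

lemma tour_from_alpha:
  assumes alpha: "\<alpha> \<in> F \<rightarrow> unordered_pairs I" and F_ne: "F \<noteq> {}"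
    and only: "only_nonempty_component (G_alpha I F \<alpha>) C"
    and tour: "euler_tour (H_component H F Hc \<alpha> C) vs es"
    and empty_outside: "\<forall>i \<in> I - verts C. edges (Hc i) = {}"
  shows "\<exists>es'. euler_tour H vs es'"
proof -
  let ?HC = "H_component H F Hc \<alpha> C"
  have C_comp: "C \<in> components (G_alpha I F \<alpha>)"
    using only by (simp add: only_nonempty_component_def)
  then have C_I: "verts C \<subseteq> I" and C_ends: "ends C = \<alpha>"
    by (auto simp: components_def subhypergraph_def G_alpha_def)
  \<comment> \<open>Every \<open>f\<close> in \<open>F\<close> is an edge of some component of \<open>G\<^sub>\<alpha>\<close>, hence of the only one with edges.\<close>
  have F_C: "f \<in> edges C" if "f \<in> F" for f
  proof -
    have "f \<in> edges (G_alpha I F \<alpha>)" using that by (simp add: G_alpha_def)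
    then obtain L where "L \<in> components (G_alpha I F \<alpha>)" "f \<in> edges L"
      using components_cover_edges[OF wf_G_alpha[OF alpha F_ne]] by blast
    then show ?thesis using only by (auto simp: only_nonempty_component_def)
  qed
  then have HC: "edges ?HC = (SIGMA i:verts C. edges (Hc i)) <+> F"
    "ends ?HC = case_sum (\<lambda>(i, e). ends (Hc i) e)
      (\<lambda>f. ends H f \<inter> (\<Union>i\<in>verts C. verts (Hc i)))"
    by (auto simp: H_component_def adjoin_edges_def hypergraph_Union_def C_ends)
  define unlabel :: "'i \<times> 'e + 'e \<Rightarrow> 'e" where "unlabel = case_sum snd id"
  have unlabel_edges: "unlabel ` edges ?HC = edges H"
  proof (rule equalityI; rule subsetI)
    fix e assume "e \<in> unlabel ` edges ?HC"
    then show "e \<in> edges H" using piece_edge(1) F_edges C_I by (auto simp: HC unlabel_def)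
  next
    fix e assume e: "e \<in> edges H"
    show "e \<in> unlabel ` edges ?HC"
    proof (cases "e \<in> F")
      case True
      then have "Inr e \<in> edges ?HC" by (auto simp: HC)
      then show ?thesis by (force simp: unlabel_def)
    next
      case False
      then obtain i where "i \<in> I" "e \<in> edges (Hc i)" using edge_in_piece e by blast
      then have "Inl (i, e) \<in> edges ?HC" using empty_outside by (auto simp: HC)
      then show ?thesis by (force simp: unlabel_def)
    qed
  qed
  have inj: "inj_on unlabel (edges ?HC)"
  proof (rule inj_onI)
    fix x y assume "x \<in> edges ?HC" "y \<in> edges ?HC" "unlabel x = unlabel y"
    then show "x = y"
      using piece_edge(2) piece_edge_unique C_I by (auto simp: HC unlabel_def subset_iff)
  qed
  have ends_sub: "ends ?HC x \<subseteq> ends H (unlabel x)" if "x \<in> edges ?HC" for x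
    using that piece_edge(3) C_I by (auto simp: HC unlabel_def subset_iff)
  have verts_sub: "verts ?HC \<subseteq> verts H"
    using C_I verts_pieces by (auto simp: verts_H_component)
  have w: "walk ?HC vs es" and cl: "hd vs = last vs" and dist: "distinct es"
    and all: "set es = edges ?HC"
    using tour by (auto simp: euler_tour_def closed_strict_trail_def)
  have "walk H vs (map unlabel es)"
    unfolding walk_def
  proof (intro conjI allI impI)
    fix k assume "k < length (map unlabel es)"
    then have k: "k < length es" by simp
    then have "ends ?HC (es ! k) \<subseteq> ends H (unlabel (es ! k))"
      using all nth_mem ends_sub by blast
    then show "vs ! k \<noteq> vs ! Suc k" "vs ! k \<in> ends H (map unlabel es ! k)"
      "vs ! Suc k \<in> ends H (map unlabel es ! k)"
      using w k unfolding walk_def by (auto simp: subset_iff)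
  qed (use w all unlabel_edges verts_sub in \<open>auto simp: walk_def\<close>)
  then have "euler_tour H vs (map unlabel es)"
    using cl dist all unlabel_edges inj
    by (simp add: euler_tour_def closed_strict_trail_def distinct_map)
  then show ?thesis by blast
qed

end

theorem corollary7p4p2:
  fixes H :: "('v, 'e) hypergraph"
    and F :: "'e set"
    and I :: "'i set"
    and Hc :: "'i \<Rightarrow> ('v, 'e) hypergraph"
  assumes "wf_hypergraph H"
    and "connected_hypergraph H"
    and "edges H \<noteq> {}"
    and "no_empty_edges H"
    and "minimal_edge_cut H F"
    and "bij_betw Hc I (components (delete_edges H F))"
  shows
    "((\<exists>vs es. euler_tour H vs es) \<longleftrightarrow>
       (\<exists>\<alpha> \<in> F \<rightarrow> unordered_pairs I. \<exists>C.
          only_nonempty_component (G_alpha I F \<alpha>) C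
          \<and> (\<exists>vs es. euler_tour (H_component H F Hc \<alpha> C) vs es)
          \<and> (\<forall>i \<in> I - verts C. edges (Hc i) = {})))
     \<and>
     ((\<exists>vs es. spanning_euler_tour H vs es) \<longleftrightarrow>
       (\<exists>\<alpha> \<in> F \<rightarrow> unordered_pairs I. \<exists>C.
          only_nonempty_component (G_alpha I F \<alpha>) C
          \<and> (\<exists>vs es. spanning_euler_tour (H_component H F Hc \<alpha> C) vs es)
          \<and> (\<forall>i \<in> I - verts C. edges (Hc i) = {})
          \<and> components (G_alpha I F \<alpha>) = {C}))"
proof -
  have cut: "edge_cut H F" using assms(5) by (simp add: minimal_edge_cut_def)
  then have "F \<subseteq> edges H" by (auto simp: edge_cut_def cut_edges_def)
  then interpret indexed_pieces H F I Hc
    using assms by unfold_locales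
  have F_ne: "F \<noteq> {}" using edge_cut_nonempty assms(2) cut .
  \<comment> \<open>The extra condition of the spanning version, read as a condition on the vertices of \<open>C\<close>.\<close>
  have sole: "components (G_alpha I F \<alpha>) = {C} \<longleftrightarrow> verts C = I"
    if "\<alpha> \<in> F \<rightarrow> unordered_pairs I" "only_nonempty_component (G_alpha I F \<alpha>) C" for \<alpha> C
    using sole_component_iff_spanning[OF wf_G_alpha[OF that(1) F_ne]] that(2)
    by (auto simp: only_nonempty_component_def G_alpha_def)
  let ?Q = "\<lambda>\<alpha> C. only_nonempty_component (G_alpha I F \<alpha>) C
    \<and> (\<exists>vs es. euler_tour (H_component H F Hc \<alpha> C) vs es)
    \<and> (\<forall>i \<in> I - verts C. edges (Hc i) = {})"
  let ?R = "\<lambda>\<alpha> C. only_nonempty_component (G_alpha I F \<alpha>) C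
    \<and> (\<exists>vs es. spanning_euler_tour (H_component H F Hc \<alpha> C) vs es)
    \<and> (\<forall>i \<in> I - verts C. edges (Hc i) = {}) \<and> components (G_alpha I F \<alpha>) = {C}"
  have spanning_left: "\<exists>\<alpha> \<in> F \<rightarrow> unordered_pairs I. \<exists>C. ?R \<alpha> C" if "spanning_euler_tour H vs es" for vs es
  proof -
    have tour: "euler_tour H vs es" and span: "verts H \<subseteq> set vs"
      using that by (auto simp: spanning_euler_tour_def)
    obtain \<alpha> C es' where *: "\<alpha> \<in> F \<rightarrow> unordered_pairs I"
      "only_nonempty_component (G_alpha I F \<alpha>) C"
      "verts C = {i \<in> I. set vs \<inter> verts (Hc i) \<noteq> {}}"
      "euler_tour (H_component H F Hc \<alpha> C) vs es'"
      "\<forall>i \<in> I - verts C. edges (Hc i) = {}"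
      using tour_yields_alpha[OF tour F_ne] by (elim bexE exE conjE)
    have "set vs \<inter> verts (Hc i) \<noteq> {}" if "i \<in> I" for i
      using piece_verts[OF that] span by blast
    then have "verts C = I" unfolding *(3) by blast
    moreover have "spanning_euler_tour (H_component H F Hc \<alpha> C) vs es'"
      using *(4) span verts_pieces \<open>verts C = I\<close>
      by (simp add: spanning_euler_tour_def verts_H_component)
    moreover have "components (G_alpha I F \<alpha>) = {C}"
      using sole[OF *(1,2)] \<open>verts C = I\<close> by simp
    ultimately have "?R \<alpha> C" using *(2,5) by (intro conjI exI)
    then show ?thesis using *(1) by blast
  qed
  have spanning_right: "\<exists>vs es. spanning_euler_tour H vs es"
    if alpha: "\<alpha> \<in> F \<rightarrow> unordered_pairs I" and R: "?R \<alpha> C" for \<alpha> C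
  proof -
    obtain vs es where tour: "euler_tour (H_component H F Hc \<alpha> C) vs es"
      and "verts (H_component H F Hc \<alpha> C) \<subseteq> set vs"
      using R by (auto simp: spanning_euler_tour_def)
    moreover have "verts C = I" using sole[OF alpha] R by blast
    ultimately have "verts H \<subseteq> set vs" by (simp add: verts_H_component verts_pieces)
    moreover obtain es' where "euler_tour H vs es'"
      using tour_from_alpha[OF alpha F_ne _ tour] R by blast
    ultimately show ?thesis unfolding spanning_euler_tour_def by blast
  qed
  have left: "\<exists>\<alpha> \<in> F \<rightarrow> unordered_pairs I. \<exists>C. ?Q \<alpha> C" if "euler_tour H vs es" for vs es
    using tour_yields_alpha[OF that F_ne] by (elim bexE exE conjE) (intro bexI exI conjI)
  have right: "\<exists>vs es. euler_tour H vs es" if "\<alpha> \<in> F \<rightarrow> unordered_pairs I" "?Q \<alpha> C" for \<alpha> C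
    using tour_from_alpha[OF that(1) F_ne] that(2) by blast
  show ?thesis
    by (intro conjI iffI; elim bexE exE; rule left right spanning_left spanning_right; assumption)
qed

end
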